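(* Consider an MTDC system controlled by the decentralized PI controller $$u_i=-K_i^P(V_i-V_i^{\text{nom}})-K_i^Iz_i,\qquad \dot z_i=V_i-V_i^{\text{nom}},\qquad i\in\mathcal{V},$$ with gains $K_i^P>0$, $K_i^I>0$. The voltage-range objective with bounds $\underline{V}_i,\overline{V}_i$ (i.e. for every constant $I^{\text{inj}}\in\mathbb{R}^n$ and every closed-loop solution, $\lim_{t\to\infty}V_i(t)\in[\underline{V}_i,\overline{V}_i]$ for all $i\in\mathcal{V}$) is satisfied if and only if $\underline{V}_i\le V_i^{\text{nom}}\le\overline{V}_i$ for all $i=1,\dots,n$.
   Context: MTDC system: let $\mathcal{G}$ be a fixed, undirected, connected graph with vertex set $\mathcal{V}=\{1,\dots,n\}$ (terminals) and edge set $\mathcal{E}$ (lines); the neighbours of $i$ are $\mathcal{N}_i$. Each edge $(i,j)$ has resistance $R_{ij}=R_{ji}>0$ and each terminal has capacitance $C_i>0$. The voltages obey $C_i\dot V_i=-\sum_{j\in\mathcal{N}_i}\frac{1}{R_{ij}}(V_i-V_j)+I_i^{\text{inj}}+u_i$ for $i\in\mathcal{V}$, where $I_i^{\text{inj}}$ is a constant uncontrolled injected current (disturbance) and $u_i$ is the controlled injected current. The nominal voltages are equal: $V_i^{\text{nom}}=V_j^{\text{nom}}$ for all $i,j\in\mathcal{V}$. *)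

theory Defs
  imports Complex_Main "Graph_Theory.Graph_Theory"
begin

(* An undirected edge {i, j} is represented by the two arcs (i, j) and (j, i)
   of a symmetric pair digraph. *)
definition neighbours :: "'a pair_pre_digraph \<Rightarrow> 'a \<Rightarrow> 'a set" where
  "neighbours G i = {j. (i, j) \<in> parcs G}"

(* Time is the half-line t \<ge> 0; the derivative at t = 0 is one-sided.
   Trajectories V, u are indexed as V i t: terminal i, time t. *)
definition mtdc_dynamics ::
  "'a pair_pre_digraph \<Rightarrow> ('a \<Rightarrow> 'a \<Rightarrow> real) \<Rightarrow> ('a \<Rightarrow> real) \<Rightarrow> ('a \<Rightarrow> real)
    \<Rightarrow> ('a \<Rightarrow> real \<Rightarrow> real) \<Rightarrow> ('a \<Rightarrow> real \<Rightarrow> real) \<Rightarrow> bool" where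
  "mtdc_dynamics G R C Iinj u V \<longleftrightarrow>
    (\<forall>i\<in>pverts G. \<forall>t\<ge>0. \<exists>V'.
      (V i has_real_derivative V') (at t within {0..}) \<and>
      C i * V' = - (\<Sum>j\<in>neighbours G i. 1 / R i j * (V i t - V j t)) + Iinj i + u i t)"

definition pi_control ::
  "('a \<Rightarrow> real) \<Rightarrow> ('a \<Rightarrow> real) \<Rightarrow> ('a \<Rightarrow> real)
    \<Rightarrow> ('a \<Rightarrow> real \<Rightarrow> real) \<Rightarrow> ('a \<Rightarrow> real \<Rightarrow> real) \<Rightarrow> 'a \<Rightarrow> real \<Rightarrow> real" where
  "pi_control KP KI Vnom V z i t = - KP i * (V i t - Vnom i) - KI i * z i t"

(* No initial condition is imposed on V or on the integrator state z. *)
definition pi_closed_loop ::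
  "'a pair_pre_digraph \<Rightarrow> ('a \<Rightarrow> 'a \<Rightarrow> real) \<Rightarrow> ('a \<Rightarrow> real) \<Rightarrow> ('a \<Rightarrow> real)
    \<Rightarrow> ('a \<Rightarrow> real) \<Rightarrow> ('a \<Rightarrow> real) \<Rightarrow> ('a \<Rightarrow> real)
    \<Rightarrow> ('a \<Rightarrow> real \<Rightarrow> real) \<Rightarrow> ('a \<Rightarrow> real \<Rightarrow> real) \<Rightarrow> bool" where
  "pi_closed_loop G R C KP KI Vnom Iinj V z \<longleftrightarrow>
    mtdc_dynamics G R C Iinj (pi_control KP KI Vnom V z) V \<and>
    (\<forall>i\<in>pverts G. \<forall>t\<ge>0. (z i has_real_derivative V i t - Vnom i) (at t within {0..}))"

(* closed_loop Iinj V: V is the voltage trajectory of some closed-loop solution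
   under the injected currents Iinj. The objective includes the existence of
   the limits. *)
definition voltage_range_objective ::
  "'a pair_pre_digraph \<Rightarrow> (('a \<Rightarrow> real) \<Rightarrow> ('a \<Rightarrow> real \<Rightarrow> real) \<Rightarrow> bool)
    \<Rightarrow> ('a \<Rightarrow> real) \<Rightarrow> ('a \<Rightarrow> real) \<Rightarrow> bool" where
  "voltage_range_objective G closed_loop Vmin Vmax \<longleftrightarrow>
    (\<forall>Iinj V. closed_loop Iinj V \<longrightarrow>
      (\<forall>i\<in>pverts G. \<exists>L\<in>{Vmin i..Vmax i}. (V i \<longlongrightarrow> L) at_top))"

end

theory Submission
  imports Defs
begin

text \<open>
  Necessity: the equilibrium at the nominal voltages, with zero integrator states and zero
  injected currents, is a closed-loop solution, so its limit must lie in the prescribed range.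

  Sufficiency: every closed-loop voltage converges to its nominal value. The integrators absorb
  the injected currents: with \<open>x i = V i - Vnom i\<close> and \<open>w i = z i - Iinj i / KI i\<close> the closed loop
  becomes \<open>w' = x\<close> and \<open>C x' = - L x - KP x - KI w\<close>, where \<open>L\<close> is the weighted graph Laplacian;
  equality of the nominal voltages is what makes \<open>L V = L x\<close>. The energy
  \<open>(\<Sum>i. C i * (x i)\<^sup>2 + KI i * (w i)\<^sup>2) / 2\<close> has derivative \<open>- x\<^sup>T L x - (\<Sum>i. KP i * (x i)\<^sup>2)\<close>, and
  \<open>x\<^sup>T L x \<ge> 0\<close> (\<open>laplacian_form_nonneg\<close>). The energy therefore stays bounded, hence so do
  \<open>x\<close>, \<open>w\<close> and \<open>x'\<close>. It dissipates at rate at least \<open>KP i * (x i)\<^sup>2\<close>, so a Barbalat argument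
  (\<open>dissipation_imp_tendsto_zero\<close>) forces each \<open>x i\<close> to vanish in the limit.
\<close>

lemma mean_value_half_line:
  fixes f :: "real \<Rightarrow> real"
  assumes "\<And>t. t \<ge> 0 \<Longrightarrow> (f has_real_derivative f' t) (at t within {0..})"
    and "0 \<le> s" and "s < t"
  obtains r where "s < r" "r < t" "f t - f s = f' r * (t - s)"
proof -
  have "continuous_on {s..t} f"
    using \<open>0 \<le> s\<close>
    by (intro DERIV_continuous_on[where D = f'] DERIV_subset[OF assms(1)]) auto
  moreover have "(f has_derivative (\<lambda>y. f' r * y)) (at r)" if "s < r" for r
  proof -
    have "(f has_real_derivative f' r) (at r within {0<..})"
      using that \<open>0 \<le> s\<close> by (intro DERIV_subset[OF assms(1)]) auto
    then show ?thesis
      using that \<open>0 \<le> s\<close> by (simp add: at_within_open[of r "{0<..}"] has_field_derivative_def)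
  qed
  ultimately obtain r where "s < r" "r < t" "f t - f s = f' r * (t - s)"
    using mvt[OF \<open>s < t\<close>, of f "\<lambda>r y. f' r * y"] by blast
  then show thesis by (rule that)
qed

lemma antimono_on_half_line:
  fixes f :: "real \<Rightarrow> real"
  assumes "\<And>t. t \<ge> 0 \<Longrightarrow> (f has_real_derivative f' t) (at t within {0..})"
    and "\<And>t. t \<ge> 0 \<Longrightarrow> f' t \<le> 0"
    and "0 \<le> s" and "s \<le> t"
  shows "f t \<le> f s"
proof (cases "s = t")
  case False
  then have "s < t" using assms by simp
  obtain r where "s < r" and r: "f t - f s = f' r * (t - s)"
    using mean_value_half_line[OF assms(1) \<open>0 \<le> s\<close> \<open>s < t\<close>] by blast
  have "f' r * (t - s) \<le> 0"
    using assms(2)[of r] \<open>s < r\<close> \<open>0 \<le> s\<close> \<open>s < t\<close> by (intro mult_nonpos_nonneg) auto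
  then show ?thesis using r by simp
qed simp

text \<open>
  Barbalat's argument without integrals: if \<open>\<bar>x t\<bar> \<ge> \<epsilon>\<close>, the Lipschitz bound keeps
  \<open>\<bar>x\<bar> \<ge> \<epsilon> / 2\<close> on a time interval of a length that does not depend on \<open>t\<close>, so the energy drops
  there by a fixed amount. An energy that is bounded below affords such a drop only at early times.
\<close>
lemma dissipation_imp_tendsto_zero:
  fixes E x :: "real \<Rightarrow> real"
  assumes E: "\<And>t. t \<ge> 0 \<Longrightarrow> (E has_real_derivative E' t) (at t within {0..})"
    and E'_le: "\<And>t. t \<ge> 0 \<Longrightarrow> E' t \<le> - k * (x t)\<^sup>2"
    and E_ge: "\<And>t. t \<ge> 0 \<Longrightarrow> b \<le> E t"
    and "k > 0"
    and x: "\<And>t. t \<ge> 0 \<Longrightarrow> (x has_real_derivative x' t) (at t within {0..})"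
    and x'_le: "\<And>t. t \<ge> 0 \<Longrightarrow> \<bar>x' t\<bar> \<le> M"
  shows "(x \<longlongrightarrow> 0) at_top"
proof (rule tendstoI)
  fix \<epsilon> :: real assume "\<epsilon> > 0"
  \<comment> \<open>\<open>M\<close> may be \<open>0\<close>, but \<open>\<delta>\<close> divides by the Lipschitz constant.\<close>
  define M' where "M' = max M 1"
  have "M' > 0" by (simp add: M'_def)
  have x'_le': "\<bar>x' t\<bar> \<le> M'" if "t \<ge> 0" for t
    using x'_le[OF that] by (simp add: M'_def)
  \<comment> \<open>Within time \<open>\<delta>\<close> the signal moves by at most \<open>\<epsilon> / 2\<close>; \<open>\<eta>\<close> is the energy lost meanwhile if it
    started at distance \<open>\<epsilon>\<close> from zero.\<close>
  define \<delta> where "\<delta> = \<epsilon> / (2 * M')"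
  have "\<delta> > 0" using \<open>\<epsilon> > 0\<close> \<open>M' > 0\<close> by (simp add: \<delta>_def)
  define \<eta> where "\<eta> = k * (\<epsilon> / 2)\<^sup>2 * \<delta>"
  have "\<eta> > 0" using \<open>\<epsilon> > 0\<close> \<open>\<delta> > 0\<close> \<open>k > 0\<close> by (simp add: \<eta>_def)
  have E'_nonpos: "E' t \<le> 0" if "t \<ge> 0" for t
    using E'_le[OF that] \<open>k > 0\<close> by (smt (verit) mult_nonneg_nonneg mult_minus_left zero_le_power2)
  have bdd: "bdd_below (E ` {0..})" using E_ge by (intro bdd_belowI[of _ b]) auto
  obtain T where "T \<ge> 0" and T: "E T < Inf (E ` {0..}) + \<eta>"
    using cInf_lessD[of "E ` {0..}" "Inf (E ` {0..}) + \<eta>"] \<open>\<eta> > 0\<close> by auto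
  have "\<bar>x t\<bar> < \<epsilon>" if "t \<ge> T" for t
  proof (rule ccontr)
    assume far: "\<not> \<bar>x t\<bar> < \<epsilon>"
    have "t \<ge> 0" using that \<open>T \<ge> 0\<close> by simp
    have "t < t + \<delta>" using \<open>\<delta> > 0\<close> by simp
    obtain r where r: "t < r" "r < t + \<delta>" "E (t + \<delta>) - E t = E' r * (t + \<delta> - t)"
      using mean_value_half_line[OF E \<open>t \<ge> 0\<close> \<open>t < t + \<delta>\<close>] by blast
    obtain q where q: "t < q" "x r - x t = x' q * (r - t)"
      using mean_value_half_line[OF x \<open>t \<ge> 0\<close> \<open>t < r\<close>] by blast
    have "\<bar>x r - x t\<bar> = \<bar>x' q\<bar> * (r - t)" using q r by (simp add: abs_mult)
    also have "\<dots> \<le> M' * \<delta>"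
      using x'_le'[of q] q r \<open>t \<ge> 0\<close> \<open>M' > 0\<close> by (intro mult_mono) auto
    also have "\<dots> = \<epsilon> / 2" using \<open>M' > 0\<close> by (simp add: \<delta>_def)
    finally have "\<epsilon> / 2 \<le> \<bar>x r\<bar>" using far by linarith
    then have "(\<epsilon> / 2)\<^sup>2 \<le> (x r)\<^sup>2" using \<open>\<epsilon> > 0\<close> power_mono[of "\<epsilon> / 2" "\<bar>x r\<bar>" 2] by simp
    then have "k * (\<epsilon> / 2)\<^sup>2 \<le> k * (x r)\<^sup>2" using \<open>k > 0\<close> by (intro mult_left_mono) auto
    then have "E' r \<le> - (k * (\<epsilon> / 2)\<^sup>2)" using E'_le[of r] r \<open>t \<ge> 0\<close> by simp
    then have "E' r * \<delta> \<le> - (k * (\<epsilon> / 2)\<^sup>2) * \<delta>" using \<open>\<delta> > 0\<close> by (intro mult_right_mono) auto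
    then have "E (t + \<delta>) \<le> E t - \<eta>" using r by (simp add: \<eta>_def)
    moreover have "E t \<le> E T"
      using antimono_on_half_line[OF E E'_nonpos \<open>T \<ge> 0\<close> that] by simp
    moreover have "Inf (E ` {0..}) \<le> E (t + \<delta>)"
      using bdd \<open>t \<ge> 0\<close> \<open>\<delta> > 0\<close> by (intro cInf_lower) auto
    ultimately show False using T by linarith
  qed
  then show "\<forall>\<^sub>F t in at_top. dist (x t) 0 < \<epsilon>"
    by (auto simp: eventually_at_top_linorder dist_real_def)
qed

text \<open>
  Adding the sum to its copy with the two ends of every arc exchanged turns each term into
  \<open>a i j * (x i - x j)\<^sup>2\<close>.
\<close>
lemma laplacian_form_nonneg:
  fixes a :: "'a \<Rightarrow> 'a \<Rightarrow> real" and x :: "'a \<Rightarrow> real"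
  assumes "sym A"
    and a_sym: "\<And>i j. (i, j) \<in> A \<Longrightarrow> a i j = a j i"
    and a_nonneg: "\<And>i j. (i, j) \<in> A \<Longrightarrow> a i j \<ge> 0"
  shows "0 \<le> (\<Sum>(i, j)\<in>A. a i j * (x i - x j) * x i)" (is "0 \<le> ?S")
proof -
  have "?S = (\<Sum>(i, j)\<in>A. a j i * (x j - x i) * x j)"
    using \<open>sym A\<close>
    by (intro sum.reindex_bij_witness[of _ prod.swap prod.swap]) (auto dest: symD)
  also have "\<dots> = (\<Sum>(i, j)\<in>A. a i j * (x j - x i) * x j)"
    by (rule sum.cong[OF refl]) (clarsimp, metis a_sym)
  finally have "2 * ?S = (\<Sum>(i, j)\<in>A. a i j * (x i - x j) * x i) + (\<Sum>(i, j)\<in>A. a i j * (x j - x i) * x j)"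
    by simp
  also have "\<dots> = (\<Sum>(i, j)\<in>A. a i j * (x i - x j)\<^sup>2)"
    unfolding sum.distrib[symmetric]
    by (intro sum.cong) (auto simp: algebra_simps power2_eq_square)
  also have "\<dots> \<ge> 0" using a_nonneg by (intro sum_nonneg) auto
  finally show ?thesis by simp
qed

text \<open>
  The closed loop in shifted coordinates: \<open>x\<close> is the voltage deviation and \<open>w\<close> the integrator
  state relative to its equilibrium value. In the derivative of the energy \<open>E\<close> the integrator
  terms \<open>ki i * w i t * x i t\<close> cancel, so only the network and the proportional gains dissipate.
\<close>
lemma damped_network_tendsto_zero:
  fixes a :: "'a \<Rightarrow> 'a \<Rightarrow> real" and C kp ki :: "'a \<Rightarrow> real" and x x' w :: "'a \<Rightarrow> real \<Rightarrow> real"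
  assumes "finite S" and "A \<subseteq> S \<times> S" and "sym A"
    and a_sym: "\<And>i j. (i, j) \<in> A \<Longrightarrow> a i j = a j i"
    and a_nonneg: "\<And>i j. (i, j) \<in> A \<Longrightarrow> a i j \<ge> 0"
    and C: "\<And>i. i \<in> S \<Longrightarrow> C i > 0"
    and kp: "\<And>i. i \<in> S \<Longrightarrow> kp i > 0"
    and ki: "\<And>i. i \<in> S \<Longrightarrow> ki i > 0"
    and x: "\<And>i t. i \<in> S \<Longrightarrow> t \<ge> 0 \<Longrightarrow> (x i has_real_derivative x' i t) (at t within {0..})"
    and w: "\<And>i t. i \<in> S \<Longrightarrow> t \<ge> 0 \<Longrightarrow> (w i has_real_derivative x i t) (at t within {0..})"
    and dyn: "\<And>i t. i \<in> S \<Longrightarrow> t \<ge> 0 \<Longrightarrow>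
      C i * x' i t = - (\<Sum>j | (i, j) \<in> A. a i j * (x i t - x j t)) - kp i * x i t - ki i * w i t"
    and "i \<in> S"
  shows "(x i \<longlongrightarrow> 0) at_top"
proof -
  define E where "E t = (\<Sum>i\<in>S. C i * (x i t)\<^sup>2 + ki i * (w i t)\<^sup>2) / 2" for t
  define E' where "E' t = (\<Sum>i\<in>S. C i * x' i t * x i t + ki i * x i t * w i t)" for t
  have fin: "finite {j. (i, j) \<in> A}" for i
    using \<open>finite S\<close> by (rule finite_subset[rotated]) (use \<open>A \<subseteq> S \<times> S\<close> in auto)
  have E: "(E has_real_derivative E' t) (at t within {0..})" if "t \<ge> 0" for t
  proof -
    have "((\<lambda>t. C i * (x i t)\<^sup>2 + ki i * (w i t)\<^sup>2) has_real_derivative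
        2 * (C i * x' i t * x i t + ki i * x i t * w i t)) (at t within {0..})" if "i \<in> S" for i
      using x[OF that \<open>t \<ge> 0\<close>] w[OF that \<open>t \<ge> 0\<close>]
      by (auto intro!: derivative_eq_intros simp: algebra_simps)
    then have "((\<lambda>t. \<Sum>i\<in>S. C i * (x i t)\<^sup>2 + ki i * (w i t)\<^sup>2) has_real_derivative
        (\<Sum>i\<in>S. 2 * (C i * x' i t * x i t + ki i * x i t * w i t))) (at t within {0..})"
      by (rule DERIV_sum)
    from DERIV_cdivide[OF this, where c = 2] show ?thesis
      unfolding E_def[abs_def] E'_def by (simp only: sum_distrib_left[symmetric]) simp
  qed
  have E'_le: "E' t \<le> - (\<Sum>i\<in>S. kp i * (x i t)\<^sup>2)" if "t \<ge> 0" for t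
  proof -
    have "(\<Sum>i\<in>S. \<Sum>j | (i, j) \<in> A. a i j * (x i t - x j t) * x i t)
        = (\<Sum>(i, j)\<in>A. a i j * (x i t - x j t) * x i t)"
      using \<open>finite S\<close> fin \<open>A \<subseteq> S \<times> S\<close>
      by (subst sum.Sigma) (auto intro!: sum.cong)
    moreover have "\<dots> \<ge> 0"
      by (rule laplacian_form_nonneg[OF \<open>sym A\<close> a_sym a_nonneg])
    moreover have "E' t = (\<Sum>i\<in>S. - (\<Sum>j | (i, j) \<in> A. a i j * (x i t - x j t) * x i t) - kp i * (x i t)\<^sup>2)"
      unfolding E'_def
    proof (rule sum.cong[OF refl])
      fix i assume "i \<in> S"
      show "C i * x' i t * x i t + ki i * x i t * w i t
          = - (\<Sum>j | (i, j) \<in> A. a i j * (x i t - x j t) * x i t) - kp i * (x i t)\<^sup>2"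
        unfolding dyn[OF \<open>i \<in> S\<close> that] sum_distrib_right[symmetric]
        by (simp add: algebra_simps power2_eq_square)
    qed
    ultimately show ?thesis by (simp add: sum_subtractf sum_negf)
  qed
  have kp_nonneg: "kp i * (x i t)\<^sup>2 \<ge> 0" if "i \<in> S" for i t
    using kp[OF that] by simp
  have E'_nonpos: "E' t \<le> 0" if "t \<ge> 0" for t
    using E'_le[OF that] sum_nonneg[of S "\<lambda>i. kp i * (x i t)\<^sup>2"] kp_nonneg by force
  have E_le: "E t \<le> E 0" if "t \<ge> 0" for t
    using antimono_on_half_line[OF E E'_nonpos _ that] by simp
  have summand: "C i * (x i t)\<^sup>2 + ki i * (w i t)\<^sup>2 \<le> 2 * E 0" if "i \<in> S" "t \<ge> 0" for i t
  proof -
    have "C i * (x i t)\<^sup>2 + ki i * (w i t)\<^sup>2 \<le> 2 * E t"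
      unfolding E_def using \<open>finite S\<close> that C ki
      by (auto intro!: member_le_sum[where f = "\<lambda>i. C i * (x i t)\<^sup>2 + ki i * (w i t)\<^sup>2"]
          add_nonneg_nonneg mult_nonneg_nonneg simp: less_imp_le)
    then show ?thesis using E_le[OF \<open>t \<ge> 0\<close>] by simp
  qed
  \<comment> \<open>Each quadratic term of the energy is at most its initial value, which bounds every state.\<close>
  define X where "X i = sqrt (2 * E 0 / C i)" for i
  define W where "W i = sqrt (2 * E 0 / ki i)" for i
  have X: "\<bar>x i t\<bar> \<le> X i" and W: "\<bar>w i t\<bar> \<le> W i" if "i \<in> S" "t \<ge> 0" for i t
  proof -
    have "C i * (x i t)\<^sup>2 \<ge> 0" "ki i * (w i t)\<^sup>2 \<ge> 0"
      using C[OF \<open>i \<in> S\<close>] ki[OF \<open>i \<in> S\<close>] by auto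
    then have "C i * (x i t)\<^sup>2 \<le> 2 * E 0" "ki i * (w i t)\<^sup>2 \<le> 2 * E 0"
      using summand[OF that] by linarith+
    then have "(x i t)\<^sup>2 \<le> 2 * E 0 / C i" "(w i t)\<^sup>2 \<le> 2 * E 0 / ki i"
      using C[OF \<open>i \<in> S\<close>] ki[OF \<open>i \<in> S\<close>] by (simp_all add: field_simps)
    then show "\<bar>x i t\<bar> \<le> X i" "\<bar>w i t\<bar> \<le> W i"
      unfolding X_def W_def by (auto intro!: real_le_rsqrt)
  qed
  define M where "M = ((\<Sum>j | (i, j) \<in> A. a i j * (X i + X j)) + kp i * X i + ki i * W i) / C i"
  have M: "\<bar>x' i t\<bar> \<le> M" if "t \<ge> 0" for t
  proof -
    have "\<bar>\<Sum>j | (i, j) \<in> A. a i j * (x i t - x j t)\<bar> \<le> (\<Sum>j | (i, j) \<in> A. a i j * (X i + X j))"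
    proof (rule order_trans[OF sum_abs], rule sum_mono)
      fix j assume "j \<in> {j. (i, j) \<in> A}"
      then have "j \<in> S" "a i j \<ge> 0" using \<open>A \<subseteq> S \<times> S\<close> a_nonneg by auto
      moreover have "\<bar>x i t - x j t\<bar> \<le> X i + X j"
        using X[OF \<open>i \<in> S\<close> that] X[OF \<open>j \<in> S\<close> that] by linarith
      ultimately show "\<bar>a i j * (x i t - x j t)\<bar> \<le> a i j * (X i + X j)"
        by (simp add: abs_mult mult_left_mono)
    qed
    moreover have "\<bar>kp i * x i t\<bar> \<le> kp i * X i" "\<bar>ki i * w i t\<bar> \<le> ki i * W i"
      using X[OF \<open>i \<in> S\<close> that] W[OF \<open>i \<in> S\<close> that] kp[OF \<open>i \<in> S\<close>] ki[OF \<open>i \<in> S\<close>]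
      by (simp_all add: abs_mult)
    ultimately have "\<bar>C i * x' i t\<bar> \<le> M * C i"
      unfolding dyn[OF \<open>i \<in> S\<close> that] M_def using C[OF \<open>i \<in> S\<close>] by simp
    then show ?thesis using C[OF \<open>i \<in> S\<close>] by (simp add: abs_mult mult.commute)
  qed
  show ?thesis
  proof (rule dissipation_imp_tendsto_zero[OF E _ _ kp[OF \<open>i \<in> S\<close>] x[OF \<open>i \<in> S\<close>] M])
    fix t :: real assume "t \<ge> 0"
    have "kp i * (x i t)\<^sup>2 \<le> (\<Sum>i\<in>S. kp i * (x i t)\<^sup>2)"
      using \<open>i \<in> S\<close> \<open>finite S\<close> kp_nonneg
      by (intro member_le_sum[where f = "\<lambda>i. kp i * (x i t)\<^sup>2"]) auto
    then show "E' t \<le> - kp i * (x i t)\<^sup>2" using E'_le[OF \<open>t \<ge> 0\<close>] by simp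
    show "0 \<le> E t"
      unfolding E_def using C ki by (auto intro!: sum_nonneg add_nonneg_nonneg simp: less_imp_le)
  qed
qed

lemma pi_closed_loop_tendsto_nominal:
  fixes G :: "'a pair_pre_digraph"
  assumes "pair_graph G"
    and R_sym: "\<And>i j. (i, j) \<in> parcs G \<Longrightarrow> R i j = R j i"
    and R_pos: "\<And>i j. (i, j) \<in> parcs G \<Longrightarrow> R i j > 0"
    and C: "\<And>i. i \<in> pverts G \<Longrightarrow> C i > 0"
    and Vnom: "\<And>i j. i \<in> pverts G \<Longrightarrow> j \<in> pverts G \<Longrightarrow> Vnom i = Vnom j"
    and KP: "\<And>i. i \<in> pverts G \<Longrightarrow> KP i > 0"
    and KI: "\<And>i. i \<in> pverts G \<Longrightarrow> KI i > 0"
    and loop: "pi_closed_loop G R C KP KI Vnom Iinj V z"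
    and "i \<in> pverts G"
  shows "(V i \<longlongrightarrow> Vnom i) at_top"
proof -
  interpret pair_graph G by fact
  have arcs: "parcs G \<subseteq> pverts G \<times> pverts G"
    using in_arcsD1 in_arcsD2 by auto
  have "\<exists>V'. \<forall>i\<in>pverts G. \<forall>t\<ge>0. (V i has_real_derivative V' i t) (at t within {0..}) \<and>
      C i * V' i t = - (\<Sum>j\<in>neighbours G i. 1 / R i j * (V i t - V j t)) + Iinj i
        + pi_control KP KI Vnom V z i t"
    using loop unfolding pi_closed_loop_def mtdc_dynamics_def by metis
  then obtain V' where
    V': "\<And>i t. i \<in> pverts G \<Longrightarrow> t \<ge> 0 \<Longrightarrow> (V i has_real_derivative V' i t) (at t within {0..})" and
    dyn: "\<And>i t. i \<in> pverts G \<Longrightarrow> t \<ge> 0 \<Longrightarrow>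
      C i * V' i t = - (\<Sum>j\<in>neighbours G i. 1 / R i j * (V i t - V j t)) + Iinj i
        + pi_control KP KI Vnom V z i t"
    by blast
  have "((\<lambda>t. V i t - Vnom i) \<longlongrightarrow> 0) at_top"
  proof (rule damped_network_tendsto_zero[of "pverts G" "parcs G" "\<lambda>i j. 1 / R i j" C KP KI
        "\<lambda>i t. V i t - Vnom i" V' "\<lambda>i t. z i t - Iinj i / KI i"])
    show "sym (parcs G)" using pair_sym_arcs by (simp add: symmetric_def)
    fix i t assume it: "i \<in> pverts G" "(t::real) \<ge> 0"
    show "((\<lambda>t. V i t - Vnom i) has_real_derivative V' i t) (at t within {0..})"
      using V'[OF it] by (auto intro!: derivative_eq_intros)
    show "((\<lambda>t. z i t - Iinj i / KI i) has_real_derivative V i t - Vnom i) (at t within {0..})"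
      using loop it unfolding pi_closed_loop_def by (auto intro!: derivative_eq_intros)
    have "(\<Sum>j\<in>neighbours G i. 1 / R i j * (V i t - V j t))
        = (\<Sum>j | (i, j) \<in> parcs G. 1 / R i j * ((V i t - Vnom i) - (V j t - Vnom j)))"
      unfolding neighbours_def
    proof (intro sum.cong refl)
      fix j assume "j \<in> {j. (i, j) \<in> parcs G}"
      then have "Vnom i = Vnom j" using Vnom arcs by blast
      then show "1 / R i j * (V i t - V j t) = 1 / R i j * ((V i t - Vnom i) - (V j t - Vnom j))"
        by simp
    qed
    then show "C i * V' i t = - (\<Sum>j | (i, j) \<in> parcs G. 1 / R i j * ((V i t - Vnom i) - (V j t - Vnom j)))
        - KP i * (V i t - Vnom i) - KI i * (z i t - Iinj i / KI i)"
      using KI[OF it(1)] unfolding dyn[OF it] pi_control_def by (simp add: right_diff_distrib)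
  qed (use arcs R_sym R_pos C KP KI \<open>i \<in> pverts G\<close> in \<open>auto simp: less_imp_le\<close>)
  then show ?thesis by (simp add: LIM_zero_iff)
qed

lemma pi_closed_loop_nominal_equilibrium:
  assumes "pair_graph G"
    and "\<And>i j. i \<in> pverts G \<Longrightarrow> j \<in> pverts G \<Longrightarrow> Vnom i = Vnom j"
  shows "pi_closed_loop G R C KP KI Vnom (\<lambda>i. 0) (\<lambda>i t. Vnom i) (\<lambda>i t. 0)"
proof -
  interpret pair_graph G by fact
  have "(\<Sum>j\<in>neighbours G i. 1 / R i j * (Vnom i - Vnom j)) = 0" if "i \<in> pverts G" for i
  proof (intro sum.neutral ballI)
    fix j assume "j \<in> neighbours G i"
    then have "j \<in> pverts G" using in_arcsD2 by (auto simp: neighbours_def)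
    then show "1 / R i j * (Vnom i - Vnom j) = 0" using assms(2)[OF that] by simp
  qed
  then show ?thesis
    unfolding pi_closed_loop_def mtdc_dynamics_def pi_control_def
    by (auto intro!: exI[of _ 0])
qed

theorem lemma4:
  fixes G :: "nat pair_pre_digraph" and n :: nat
    and R :: "nat \<Rightarrow> nat \<Rightarrow> real"
    and C KP KI Vnom Vmin Vmax :: "nat \<Rightarrow> real"
  assumes "pair_graph G" and "Digraph_Component.connected (with_proj G)"
    and "pverts G = {1..n}"
    and "\<And>i j. (i, j) \<in> parcs G \<Longrightarrow> R i j = R j i"
    and "\<And>i j. (i, j) \<in> parcs G \<Longrightarrow> R i j > 0"
    and "\<And>i. i \<in> pverts G \<Longrightarrow> C i > 0"
    and "\<And>i j. i \<in> pverts G \<Longrightarrow> j \<in> pverts G \<Longrightarrow> Vnom i = Vnom j"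
    and "\<And>i. i \<in> pverts G \<Longrightarrow> KP i > 0"
    and "\<And>i. i \<in> pverts G \<Longrightarrow> KI i > 0"
  shows "voltage_range_objective G
      (\<lambda>Iinj V. \<exists>z. pi_closed_loop G R C KP KI Vnom Iinj V z) Vmin Vmax
    \<longleftrightarrow> (\<forall>i\<in>{1..n}. Vmin i \<le> Vnom i \<and> Vnom i \<le> Vmax i)"
    (is "?objective \<longleftrightarrow> ?nominal_in_range")
proof
  assume ?objective
  have "\<exists>z. pi_closed_loop G R C KP KI Vnom (\<lambda>i. 0) (\<lambda>i t. Vnom i) z"
    using pi_closed_loop_nominal_equilibrium[of G Vnom, OF assms(1,7)] by blast
  then have limits: "\<forall>i\<in>pverts G. \<exists>L\<in>{Vmin i..Vmax i}. ((\<lambda>t::real. Vnom i) \<longlongrightarrow> L) at_top"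
    using \<open>?objective\<close> unfolding voltage_range_objective_def by blast
  show ?nominal_in_range
  proof
    fix i assume "i \<in> {1..n}"
    then obtain L where "L \<in> {Vmin i..Vmax i}" and "((\<lambda>t::real. Vnom i) \<longlongrightarrow> L) at_top"
      using limits assms(3) by blast
    then show "Vmin i \<le> Vnom i \<and> Vnom i \<le> Vmax i"
      by (auto simp: tendsto_const_iff)
  qed
next
  assume in_range: ?nominal_in_range
  show ?objective
    unfolding voltage_range_objective_def
  proof (intro allI impI ballI)
    fix Iinj V i
    assume "\<exists>z. pi_closed_loop G R C KP KI Vnom Iinj V z" and "i \<in> pverts G"
    then have "(V i \<longlongrightarrow> Vnom i) at_top"
      using pi_closed_loop_tendsto_nominal[of G R C Vnom KP KI, OF assms(1,4-9)] by blast
    moreover have "Vnom i \<in> {Vmin i..Vmax i}"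
      using in_range \<open>i \<in> pverts G\<close> assms(3) by simp
    ultimately show "\<exists>L\<in>{Vmin i..Vmax i}. (V i \<longlongrightarrow> L) at_top" by blast
  qed
qed

end
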